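(* Let $G$ be any finite group with a composition series $$G=N_0\unrhd N_1\unrhd\cdots\unrhd N_n=\mathrm{id}$$ (each $N_{i+1}$ is normal in $N_i$ and each quotient $N_i/N_{i+1}$ is simple). Then $$\operatorname{gw}(G)=\max_{0\le i\le n-1}\mu(N_i/N_{i+1}).$$
   Context: For a finite group $G$, the cost of a chain of subgroups $H_0\ge H_1\ge\cdots\ge H_n$ is $\max_{0\le i\le n-1}[H_i:H_{i+1}]$. A chain $G=H_0>H_1>\cdots>H_n=\mathrm{id}$ with strict inclusions is maximal if it cannot be refined to a longer chain by inserting strict subgroups. The Galois width $\operatorname{gw}(G)$ is the minimum cost over all maximal chains of subgroups $G=H_0>\cdots>H_n=\mathrm{id}$. Convention: the maximum over an empty set of indices is $1$ (so the trivial group has Galois width $1$). For a finite group $G$, $\mu(G)$ denotes the minimum degree of a faithful permutation representation of $G$, i.e. the least integer $d\ge 0$ such that there is an injective homomorphism $G\to S_d$. *)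

theory Defs
  imports "HOL-Algebra.Coset" "HOL-Algebra.SimpleGroups" "HOL-Algebra.Sym_Groups"
begin

text \<open>A chain \<open>H\<^sub>0, \<dots>, H\<^sub>n\<close> of subsets of a group is a function \<open>H :: nat \<Rightarrow> 'a set\<close> together with
  its length \<open>n\<close>; the values of \<open>H\<close> at arguments above \<open>n\<close> are irrelevant.\<close>

text \<open>Maximum of \<open>f 0, \<dots>, f (n - 1)\<close>, where the empty maximum is \<open>1\<close> by convention.\<close>

definition max_below :: "nat \<Rightarrow> (nat \<Rightarrow> nat) \<Rightarrow> nat" where
  "max_below n f = (if n = 0 then 1 else Max (f ` {..<n}))"

definition subgroup_index :: "('a, 'b) monoid_scheme \<Rightarrow> 'a set \<Rightarrow> 'a set \<Rightarrow> nat" where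
  "subgroup_index G H K = card (rcosets\<^bsub>G\<lparr>carrier := H\<rparr>\<^esub> K)"

definition chain_cost :: "('a, 'b) monoid_scheme \<Rightarrow> (nat \<Rightarrow> 'a set) \<Rightarrow> nat \<Rightarrow> nat" where
  "chain_cost G H n = max_below n (\<lambda>i. subgroup_index G (H i) (H (Suc i)))"

definition strict_subgroup_chain :: "('a, 'b) monoid_scheme \<Rightarrow> (nat \<Rightarrow> 'a set) \<Rightarrow> nat \<Rightarrow> bool" where
  "strict_subgroup_chain G H n \<longleftrightarrow>
     H 0 = carrier G \<and> H n = {\<one>\<^bsub>G\<^esub>} \<and>
     (\<forall>i\<le>n. subgroup (H i) G) \<and> (\<forall>i<n. H (Suc i) \<subset> H i)"

text \<open>As both chains are strictly decreasing, \<open>K\<close> arises from \<open>H\<close> by inserting subgroups precisely if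
  every term of \<open>H\<close> is a term of \<open>K\<close>.\<close>

definition maximal_subgroup_chain :: "('a, 'b) monoid_scheme \<Rightarrow> (nat \<Rightarrow> 'a set) \<Rightarrow> nat \<Rightarrow> bool" where
  "maximal_subgroup_chain G H n \<longleftrightarrow>
     strict_subgroup_chain G H n \<and>
     \<not> (\<exists>K m. strict_subgroup_chain G K m \<and> n < m \<and> H ` {..n} \<subseteq> K ` {..m})"

definition galois_width :: "('a, 'b) monoid_scheme \<Rightarrow> nat" where
  "galois_width G = (LEAST c. \<exists>H n. maximal_subgroup_chain G H n \<and> c = chain_cost G H n)"

definition min_faithful_degree :: "('a, 'b) monoid_scheme \<Rightarrow> nat" where
  "min_faithful_degree G = (LEAST d. \<exists>\<phi>. \<phi> \<in> mon G (sym_group d))"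

text \<open>That every \<open>N i\<close> is a subgroup of \<open>G\<close> follows from normality, starting from \<open>N 0 = carrier G\<close>.
  Simple groups are nontrivial, so the inclusions are strict.\<close>

definition composition_series :: "('a, 'b) monoid_scheme \<Rightarrow> (nat \<Rightarrow> 'a set) \<Rightarrow> nat \<Rightarrow> bool" where
  "composition_series G N n \<longleftrightarrow>
     N 0 = carrier G \<and> N n = {\<one>\<^bsub>G\<^esub>} \<and>
     (\<forall>i<n. N (Suc i) \<lhd> G\<lparr>carrier := N i\<rparr> \<and>
            simple_group (G\<lparr>carrier := N i\<rparr> Mod N (Suc i)))"

end

theory Submission
  imports Defs
begin

text \<open>Both inequalities come from the action of a group on the cosets of a subgroup.

  Lower bound: let \<open>S\<close> be a composition factor, so that \<open>S\<close> is the image of a subgroup \<open>A\<close> of \<open>G\<close>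
  under a homomorphism \<open>\<pi>\<close>, and let \<open>H\<close> be any chain from \<open>G\<close> to the trivial group. The images
  \<open>\<pi> (H j \<inter> A)\<close> descend from \<open>S\<close> to the trivial group, so some step leads from \<open>S\<close> to a proper
  subgroup \<open>L\<close>. Intersecting with \<open>A\<close> and applying \<open>\<pi>\<close> does not increase indices, so the index of
  \<open>L\<close> is at most the cost of the chain. As \<open>S\<close> is simple, it acts faithfully on the cosets of \<open>L\<close>,
  and \<open>\<mu>(S)\<close> is at most the cost (\<open>min_faithful_degree_le_chain_cost\<close>).

  Upper bound: let \<open>c\<close> be the maximum of the degrees \<open>\<mu>(N i / N (i + 1))\<close>. A faithful action of
  \<open>N i / N (i + 1)\<close> on at most \<open>c\<close> points is an action of \<open>N i\<close> with kernel \<open>N (i + 1)\<close>. Fixing the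
  points one after the other gives a chain from \<open>N i\<close> to \<open>N (i + 1)\<close> whose indices are orbit
  lengths and hence at most \<open>c\<close> (\<open>stabilizer_chain\<close>). Joined together, these give a chain from
  \<open>G\<close> to the trivial group of cost at most \<open>c\<close>. Every refinement has cost at most \<open>c\<close> as well, so
  a longest chain of cost at most \<open>c\<close> is maximal (\<open>maximal_chain_exists\<close>).\<close>

section \<open>Indices of subgroups\<close>

lemma max_below_le:
  assumes "n = 0 \<Longrightarrow> 1 \<le> c" and "\<And>i. i < n \<Longrightarrow> f i \<le> c"
  shows "max_below n f \<le> c"
proof (cases "n = 0")
  case False
  then have "f ` {..<n} \<noteq> {}" by auto
  then show ?thesis using False assms(2) by (auto simp: max_below_def)
qed (use assms(1) in \<open>simp add: max_below_def\<close>)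

lemma le_max_below: "i < n \<Longrightarrow> f i \<le> max_below n f"
  by (auto simp: max_below_def)

context group
begin

lemma rcosets_restrict: "rcosets\<^bsub>G\<lparr>carrier := H\<rparr>\<^esub> K = (\<lambda>a. K #> a) ` H"
  by (auto simp: RCOSETS_def)

text \<open>All bounds on indices below are instances of this lemma: an invariant that separates the
  cosets of \<open>K\<close> in \<open>H\<close> bounds their number. It need not be constant on cosets.\<close>

lemma subgroup_index_le_card:
  assumes "subgroup H G" "subgroup K G" "finite X" "\<And>a. a \<in> H \<Longrightarrow> f a \<in> X"
    and sep: "\<And>a b. \<lbrakk>a \<in> H; b \<in> H; f a = f b\<rbrakk> \<Longrightarrow> a \<otimes> inv b \<in> K"
  shows "subgroup_index G H K \<le> card X"
proof -
  let ?C = "(\<lambda>a. K #> a) ` H"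
  define r where "r C = (SOME a. a \<in> H \<and> K #> a = C)" for C
  have r: "r C \<in> H \<and> K #> r C = C" if "C \<in> ?C" for C
    unfolding r_def by (rule someI_ex) (use that in auto)
  have "inj_on (f \<circ> r) ?C"
  proof (rule inj_onI)
    fix C D assume C: "C \<in> ?C" and D: "D \<in> ?C" and eq: "(f \<circ> r) C = (f \<circ> r) D"
    have in_K: "r C \<otimes> inv (r D) \<in> K" using sep r[OF C] r[OF D] eq by simp
    have carr: "r C \<in> carrier G" "r D \<in> carrier G"
      using r[OF C] r[OF D] subgroup.subset[OF assms(1)] by auto
    have "K #> r C = K #> r D"
      using coset_mult_inv1[OF _ carr] coset_join2[OF _ assms(2) in_K] carr
        subgroup.subset[OF assms(2)] by simp
    then show "C = D" using r[OF C] r[OF D] by simp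
  qed
  moreover have "(f \<circ> r) ` ?C \<subseteq> X" using r assms(4) by fastforce
  ultimately show ?thesis
    unfolding subgroup_index_def rcosets_restrict using card_inj_on_le assms(3) by blast
qed

lemma subgroup_index_mono:
  assumes "finite (carrier G)" "subgroup H G" "subgroup K G" "subgroup H' G" "subgroup K' G"
    and "H' \<subseteq> H" "K \<subseteq> K'"
  shows "subgroup_index G H' K' \<le> subgroup_index G H K"
proof -
  have "subgroup_index G H' K' \<le> card ((\<lambda>a. K #> a) ` H)"
  proof (rule subgroup_index_le_card[where f = "\<lambda>a. K #> a"])
    show "finite ((\<lambda>a. K #> a) ` H)"
      using assms(1) subgroup.subset[OF assms(2)] finite_subset by blast
    fix a b assume ab: "a \<in> H'" "b \<in> H'" and eq: "K #> a = K #> b"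
    then have carr: "a \<in> carrier G" "b \<in> carrier G"
      using subgroup.subset[OF assms(4)] by auto
    then have "K #> (a \<otimes> inv b) = K"
      using coset_mult_inv2[OF eq] subgroup.subset[OF assms(3)] by simp
    then show "a \<otimes> inv b \<in> K'"
      using coset_join1[OF _ _ assms(3)] carr assms(7) by auto
  qed (use assms in auto)
  then show ?thesis by (simp add: subgroup_index_def rcosets_restrict)
qed

lemma subgroup_index_pos:
  assumes "finite (carrier G)" "subgroup H G"
  shows "0 < subgroup_index G H K"
  unfolding subgroup_index_def rcosets_restrict
  using assms finite_subset[OF subgroup.subset[OF assms(2)]] subgroup.one_closed[OF assms(2)]
  by (auto simp: card_gt_0_iff)

lemma subgroup_index_image_le:
  assumes fin: "finite (carrier G)" and H: "subgroup H G" and K: "subgroup K G"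
    and A: "subgroup A G" and S: "group S" and p: "p \<in> hom (G\<lparr>carrier := A\<rparr>) S"
    and onto: "p ` (H \<inter> A) = carrier S"
  shows "card (rcosets\<^bsub>S\<^esub> (p ` (K \<inter> A))) \<le> subgroup_index G H K"
proof -
  interpret S: group S by fact
  interpret p: group_hom "G\<lparr>carrier := A\<rparr>" S p
    using p S subgroup.subgroup_is_group[OF A] by (simp add: group_hom_def group_hom_axioms_def)
  have KA: "subgroup (p ` (K \<inter> A)) S"
    using p.subgroup_img_is_subgroup subgroup_incl[OF subgroups_Inter_pair[OF K A] A] by blast
  \<comment> \<open>Cosets in \<open>S\<close> are represented by elements of \<open>H\<close> and told apart by the cosets of \<open>K\<close>.\<close>
  define h where "h s = (SOME a. a \<in> H \<inter> A \<and> p a = s)" for s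
  have h: "h s \<in> H \<inter> A \<and> p (h s) = s" if "s \<in> carrier S" for s
    unfolding h_def by (rule someI_ex) (use that in \<open>auto simp flip: onto\<close>)
  have "subgroup_index S (carrier S) (p ` (K \<inter> A)) \<le> card ((\<lambda>a. K #> a) ` H)"
  proof (rule S.subgroup_index_le_card[where f = "\<lambda>s. K #> h s"])
    show "finite ((\<lambda>a. K #> a) ` H)"
      using fin subgroup.subset[OF H] finite_subset by blast
    show "K #> h s \<in> (\<lambda>a. K #> a) ` H" if "s \<in> carrier S" for s
      using h[OF that] by auto
    fix s t assume st: "s \<in> carrier S" "t \<in> carrier S" and eq: "K #> h s = K #> h t"
    have carr: "h s \<in> carrier G" "h t \<in> carrier G"
      using h[OF st(1)] h[OF st(2)] subgroup.subset[OF H] by auto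
    then have "h s \<otimes> inv (h t) \<in> K"
      using coset_mult_inv2[OF eq] subgroup.subset[OF K] coset_join1[OF _ _ K] by simp
    moreover have "h s \<otimes> inv (h t) \<in> A"
      using h[OF st(1)] h[OF st(2)] A by (simp add: subgroup.m_closed subgroup.m_inv_closed)
    moreover have "p (h s \<otimes> inv (h t)) = s \<otimes>\<^bsub>S\<^esub> inv\<^bsub>S\<^esub> t"
      using h[OF st(1)] h[OF st(2)] p.hom_mult[of "h s" "inv (h t)"] p.hom_inv[of "h t"]
        m_inv_consistent[OF A] subgroup.m_inv_closed[OF A] by simp
    ultimately show "s \<otimes>\<^bsub>S\<^esub> inv\<^bsub>S\<^esub> t \<in> p ` (K \<inter> A)" by (metis IntI imageI)
  qed (use KA S.subgroup_self in auto)
  then show ?thesis by (simp add: subgroup_index_def rcosets_restrict)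
qed

end

section \<open>Simple groups acting on cosets\<close>

text \<open>The action sends \<open>g\<close> to right multiplication of cosets by \<open>g\<^sup>-\<^sup>1\<close>, with the cosets numbered
  from \<open>1\<close> to the index; elsewhere the permutation is the identity.\<close>

lemma (in simple_group) coset_action_faithful:
  assumes fin: "finite (carrier G)" and L: "subgroup L G" and proper: "L \<noteq> carrier G"
  shows "\<exists>\<phi>. \<phi> \<in> mon G (sym_group (card (rcosets L)))"
proof -
  let ?d = "card (rcosets L)"
  have "finite (rcosets L)" using fin by (auto simp: RCOSETS_def)
  then obtain e where e: "bij_betw e {1..?d} (rcosets L)"
    using ex_bij_betw_nat_finite_1 by blast
  define u where "u = the_inv_into {1..?d} e"
  have u: "u C \<in> {1..?d}" "e (u C) = C" if "C \<in> rcosets L" for C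
    using e that unfolding u_def bij_betw_def
    by (simp_all add: the_inv_into_into f_the_inv_into_f del: atLeastAtMost_iff)
  have ue: "u (e x) = x" if "x \<in> {1..?d}" for x
    using e that unfolding u_def bij_betw_def by (simp add: the_inv_into_f_f)
  have e_in: "e x \<in> rcosets L" if "x \<in> {1..?d}" for x
    using e that by (auto simp: bij_betw_def)
  have Lsub: "L \<subseteq> carrier G" using L by (rule subgroup.subset)
  have sub: "C \<subseteq> carrier G" if "C \<in> rcosets L" for C
    using subgroup.rcosets_carrier[OF L is_group that] .
  have mv: "C #> g \<in> rcosets L" if C: "C \<in> rcosets L" and g: "g \<in> carrier G" for C g
  proof -
    obtain a where "a \<in> carrier G" "C = L #> a" using C by (auto simp: RCOSETS_def)
    then show ?thesis using g Lsub by (simp add: coset_mult_assoc rcosetsI)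
  qed
  define \<phi> where "\<phi> g x = (if x \<in> {1..?d} then u (e x #> inv g) else x)" for g x
  have \<phi>_in: "\<phi> g x \<in> {1..?d}" if "g \<in> carrier G" "x \<in> {1..?d}" for g x
    using that u(1) mv e_in unfolding \<phi>_def by simp
  have e\<phi>: "e (\<phi> g x) = e x #> inv g" if "g \<in> carrier G" "x \<in> {1..?d}" for g x
    using that u(2) mv e_in unfolding \<phi>_def by simp
  have \<phi>_mult: "\<phi> (g \<otimes> h) = \<phi> g \<circ> \<phi> h" if gh: "g \<in> carrier G" "h \<in> carrier G" for g h
  proof
    fix x show "\<phi> (g \<otimes> h) x = (\<phi> g \<circ> \<phi> h) x"
    proof (cases "x \<in> {1..?d}")
      case True
      have "e x #> inv (g \<otimes> h) = e (\<phi> h x) #> inv g"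
        using gh True e\<phi> sub[OF e_in] by (simp add: inv_mult_group coset_mult_assoc)
      then show ?thesis using True \<phi>_in[OF gh(2) True] by (simp add: \<phi>_def[of g] \<phi>_def[of "g \<otimes> h"])
    qed (auto simp: \<phi>_def)
  qed
  have \<phi>_one: "\<phi> \<one> = id"
    using ue sub[OF e_in] by (auto simp: \<phi>_def fun_eq_iff)
  have \<phi>_perm: "\<phi> g permutes {1..?d}" if "g \<in> carrier G" for g
  proof (rule bij_imp_permutes)
    show "bij_betw (\<phi> g) {1..?d} {1..?d}"
    proof (rule bij_betw_byWitness[where f' = "\<phi> (inv g)"])
      show "\<forall>x\<in>{1..?d}. \<phi> (inv g) (\<phi> g x) = x"
        using \<phi>_mult[of "inv g" g] \<phi>_one that by (simp add: fun_eq_iff)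
      show "\<forall>x\<in>{1..?d}. \<phi> g (\<phi> (inv g) x) = x"
        using \<phi>_mult[of g "inv g"] \<phi>_one that by (simp add: fun_eq_iff)
    qed (use \<phi>_in that in blast)+
  qed (auto simp: \<phi>_def)
  have hom: "\<phi> \<in> hom G (sym_group ?d)"
    using \<phi>_perm \<phi>_mult by (auto simp: hom_def sym_group_def)
  interpret \<phi>: group_hom G "sym_group ?d" \<phi>
    using hom sym_group_is_group by (simp add: group_hom_def group_hom_axioms_def)
  let ?K = "kernel G (sym_group ?d) \<phi>"
  \<comment> \<open>The kernel fixes the coset \<open>L\<close> itself, so it lies in \<open>L\<close>.\<close>
  have "?K \<subseteq> L"
  proof
    fix g assume "g \<in> ?K"
    then have g: "g \<in> carrier G" "\<phi> g = id"
      by (auto simp: kernel_def sym_group_one)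
    have L_in: "L \<in> rcosets L" using subgroup.subgroup_in_rcosets[OF L is_group] .
    have "L #> inv g = L"
      using e\<phi>[OF g(1) u(1)[OF L_in]] u(2)[OF L_in] g(2) by simp
    then have "inv g \<in> L" using coset_join1 g(1) L by simp
    then show "g \<in> L" using subgroup.m_inv_closed[OF L] g(1) by force
  qed
  then have "?K = {\<one>}"
    using no_real_normal_subgroup[OF \<phi>.normal_kernel] proper Lsub by blast
  then have "inj_on \<phi> (carrier G)"
    using \<phi>.inj_on_one_iff by (auto simp: kernel_def)
  then have "\<phi> \<in> mon G (sym_group ?d)" using hom by (simp add: mon_def)
  then show ?thesis by blast
qed

lemma (in simple_group) min_faithful_degree_attained:
  assumes "finite (carrier G)"
  shows "\<exists>\<phi>. \<phi> \<in> mon G (sym_group (min_faithful_degree G))"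
  unfolding min_faithful_degree_def
  by (rule LeastI_ex)
    (use coset_action_faithful[OF assms triv_subgroup] simple_not_triv in blast)

lemma (in simple_group) min_faithful_degree_pos:
  assumes "finite (carrier G)"
  shows "0 < min_faithful_degree G"
proof (rule ccontr)
  assume "\<not> 0 < min_faithful_degree G"
  then obtain \<phi> where \<phi>: "\<phi> \<in> mon G (sym_group 0)"
    using min_faithful_degree_attained[OF assms] by auto
  then have id: "\<phi> g = id" if "g \<in> carrier G" for g
    using that by (auto simp: mon_def hom_def sym_group_def)
  have "g = \<one>" if "g \<in> carrier G" for g
    using inj_onD[of \<phi> "carrier G" g \<one>] \<phi> id[OF that] id[of \<one>] that by (simp add: mon_def)
  then show False using simple_not_triv by blast
qed

text \<open>Only the homomorphic image \<open>S\<close> of the subgroup \<open>A\<close> needs to be simple, and the chain need not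
  be maximal.\<close>

lemma (in group) min_faithful_degree_le_chain_cost:
  assumes fin: "finite (carrier G)" and chain: "strict_subgroup_chain G H m"
    and A: "subgroup A G" and S: "simple_group S"
    and p: "p \<in> hom (G\<lparr>carrier := A\<rparr>) S" and onto: "p ` A = carrier S"
  shows "min_faithful_degree S \<le> chain_cost G H m"
proof -
  interpret S: simple_group S by fact
  interpret p: group_hom "G\<lparr>carrier := A\<rparr>" S p
    using p S.is_group subgroup.subgroup_is_group[OF A]
    by (simp add: group_hom_def group_hom_axioms_def)
  have H: "subgroup (H i) G" if "i \<le> m" for i
    using chain that by (simp add: strict_subgroup_chain_def)
  have H0: "H 0 = carrier G" and Hm: "H m = {\<one>}"
    using chain by (auto simp: strict_subgroup_chain_def)
  define P where "P j \<longleftrightarrow> p ` (H j \<inter> A) = carrier S" for j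
  have P0: "P 0"
    using onto subgroup.subset[OF A] by (simp add: P_def H0 Int_absorb1)
  have Pm: "\<not> P m"
    using S.simple_not_triv p.hom_one subgroup.one_closed[OF A] by (auto simp: P_def Hm)
  obtain j where j: "j < m" "P j" "\<not> P (Suc j)"
  proof -
    have "\<exists>j<m. P j \<and> \<not> P (Suc j)"
    proof (rule ccontr)
      assume *: "\<not> (\<exists>j<m. P j \<and> \<not> P (Suc j))"
      have "j \<le> m \<Longrightarrow> P j" for j by (induction j) (use P0 * in auto)
      then show False using Pm by simp
    qed
    then show ?thesis using that by blast
  qed
  let ?L = "p ` (H (Suc j) \<inter> A)"
  have finS: "finite (carrier S)"
    using onto fin subgroup.subset[OF A] finite_subset by (metis finite_imageI)
  have Hj: "subgroup (H j) G" "subgroup (H (Suc j)) G" using H j(1) by auto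
  have L: "subgroup ?L S"
    using p.subgroup_img_is_subgroup subgroup_incl[OF subgroups_Inter_pair[OF Hj(2) A] A] by blast
  have "min_faithful_degree S \<le> card (rcosets\<^bsub>S\<^esub> ?L)"
    unfolding min_faithful_degree_def
    by (rule Least_le) (use S.coset_action_faithful[OF finS L] j(3) in \<open>auto simp: P_def\<close>)
  also have "\<dots> \<le> subgroup_index G (H j) (H (Suc j))"
    using subgroup_index_image_le[OF fin Hj A S.is_group p] j(2) by (simp add: P_def)
  also have "\<dots> \<le> chain_cost G H m"
    unfolding chain_cost_def using j(1)
    by (rule le_max_below[where f = "\<lambda>i. subgroup_index G (H i) (H (Suc i))"])
  finally show ?thesis .
qed

section \<open>Chains of bounded cost\<close>

text \<open>A step of a strict chain whose index is at most \<open>c\<close>. Chains of cost at most \<open>c\<close> then are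
  the paths of this relation, and chains with repetitions may be composed in its reflexive
  transitive closure.\<close>

definition index_step :: "('a, 'b) monoid_scheme \<Rightarrow> nat \<Rightarrow> ('a set \<times> 'a set) set" where
  "index_step G c = {(H, K). subgroup H G \<and> subgroup K G \<and> K \<subset> H \<and> subgroup_index G H K \<le> c}"

context group
begin

lemma index_step_rtranclI:
  assumes "subgroup H G" "subgroup K G" "K \<subseteq> H" "subgroup_index G H K \<le> c"
  shows "(H, K) \<in> (index_step G c)\<^sup>*"
  using assms by (cases "K = H") (auto simp: index_step_def)

lemma stabilizer_chain:
  assumes A: "subgroup A G" and \<psi>: "\<psi> \<in> hom (G\<lparr>carrier := A\<rparr>) (sym_group d)" and "d \<le> c"
  shows "(A, {a \<in> A. \<psi> a = id}) \<in> (index_step G c)\<^sup>*"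
proof -
  interpret \<psi>: group_hom "G\<lparr>carrier := A\<rparr>" "sym_group d" \<psi>
    using \<psi> subgroup.subgroup_is_group[OF A] sym_group_is_group
    by (simp add: group_hom_def group_hom_axioms_def)
  have inv_A: "inv a \<in> A" if "a \<in> A" for a using A that by (rule subgroup.m_inv_closed)
  have \<psi>_mult: "\<psi> (a \<otimes> b) x = \<psi> a (\<psi> b x)" if "a \<in> A" "b \<in> A" for a b x
    using \<psi>.hom_mult[of a b] that by (simp add: sym_group_mult)
  have \<psi>_one: "\<psi> \<one> = id" using \<psi>.hom_one by (simp add: sym_group_one)
  have \<psi>_inv: "\<psi> a (\<psi> (inv a) x) = x" "\<psi> (inv a) (\<psi> a x) = x" if "a \<in> A" for a x
    using \<psi>_mult[of a "inv a" x] \<psi>_mult[of "inv a" a x] that inv_A \<psi>_one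
      subgroup.mem_carrier[OF A] by auto
  have \<psi>_perm: "\<psi> a permutes {1..d}" if "a \<in> A" for a
    using \<psi>.hom_closed that by (simp add: sym_group_carrier)
  define Q where "Q k = {a \<in> A. \<forall>x\<in>{1..k}. \<psi> a x = x}" for k
  have Q: "subgroup (Q k) G" for k
  proof (rule subgroupI)
    show "Q k \<subseteq> carrier G" using subgroup.subset[OF A] by (auto simp: Q_def)
    show "Q k \<noteq> {}" using subgroup.one_closed[OF A] \<psi>_one by (auto simp: Q_def)
    fix a assume a: "a \<in> Q k"
    have "\<psi> (inv a) x = x" if "x \<in> {1..k}" for x
      using \<psi>_inv(2)[of a x] a that by (simp add: Q_def)
    then show "inv a \<in> Q k" using inv_A a by (simp add: Q_def)
    fix b assume "b \<in> Q k"
    then show "a \<otimes> b \<in> Q k" using a \<psi>_mult subgroup.m_closed[OF A] by (auto simp: Q_def)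
  qed
  have "(A, Q k) \<in> (index_step G c)\<^sup>*" if "k \<le> d" for k
    using that
  proof (induction k)
    case 0
    then show ?case by (simp add: Q_def)
  next
    case (Suc k)
    \<comment> \<open>Right cosets of the stabilizer of \<open>k + 1\<close> correspond to the images of this point under
      inverses.\<close>
    have "subgroup_index G (Q k) (Q (Suc k)) \<le> card {1..d}"
    proof (rule subgroup_index_le_card[OF Q Q, where f = "\<lambda>a. \<psi> (inv a) (Suc k)"])
      show "\<psi> (inv a) (Suc k) \<in> {1..d}" if "a \<in> Q k" for a
      proof -
        have "inv a \<in> A" using that inv_A by (simp add: Q_def)
        then show ?thesis using \<psi>_perm Suc.prems permutes_in_image by fastforce
      qed
      fix a b assume a: "a \<in> Q k" and b: "b \<in> Q k"
        and eq: "\<psi> (inv a) (Suc k) = \<psi> (inv b) (Suc k)"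
      have AA: "a \<in> A" "b \<in> A" using a b by (auto simp: Q_def)
      have "\<psi> (a \<otimes> inv b) (Suc k) = Suc k"
        using \<psi>_mult[OF AA(1) inv_A[OF AA(2)]] eq[symmetric] \<psi>_inv(1)[OF AA(1)] by simp
      moreover have "a \<otimes> inv b \<in> Q k"
        using a b Q subgroup.m_closed subgroup.m_inv_closed by metis
      ultimately show "a \<otimes> inv b \<in> Q (Suc k)" by (auto simp: Q_def le_Suc_eq)
    qed simp
    then have "(Q k, Q (Suc k)) \<in> (index_step G c)\<^sup>*"
      using \<open>d \<le> c\<close> by (intro index_step_rtranclI Q) (auto simp: Q_def)
    then show ?case using Suc by (meson Suc_leD rtrancl_trans)
  qed
  moreover have "Q d = {a \<in> A. \<psi> a = id}"
    using \<psi>_perm permutes_not_in by (fastforce simp: Q_def fun_eq_iff)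
  ultimately show ?thesis by (metis order_refl)
qed

lemma strict_chain_antimono:
  assumes "strict_subgroup_chain G H n" "i \<le> j" "j \<le> n"
  shows "H j \<subseteq> H i"
  using assms(2,3)
proof (induction j rule: dec_induct)
  case (step k)
  then have "H (Suc k) \<subset> H k" using assms(1) by (simp add: strict_subgroup_chain_def)
  then show ?case using step by auto
qed simp

lemma strict_chain_card:
  assumes fin: "finite (carrier G)" and chain: "strict_subgroup_chain G H n" and "i \<le> n"
  shows "card (H i) + i \<le> card (carrier G)"
  using \<open>i \<le> n\<close>
proof (induction i)
  case 0
  then show ?case using chain by (simp add: strict_subgroup_chain_def)
next
  case (Suc i)
  have "H (Suc i) \<subset> H i" "subgroup (H i) G"
    using chain Suc.prems by (auto simp: strict_subgroup_chain_def)
  then have "card (H (Suc i)) < card (H i)"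
    using fin by (meson finite_subset psubset_card_mono subgroup.subset)
  then show ?case using Suc by simp
qed

text \<open>Each step of the finer chain \<open>K\<close> lies between two neighbours of the coarser chain \<open>H\<close>.\<close>

lemma chain_index_refine:
  assumes fin: "finite (carrier G)"
    and H: "strict_subgroup_chain G H n" and K: "strict_subgroup_chain G K m"
    and sub: "H ` {..n} \<subseteq> K ` {..m}"
    and idx: "\<And>j. j < n \<Longrightarrow> subgroup_index G (H j) (H (Suc j)) \<le> c" and i: "i < m"
  shows "subgroup_index G (K i) (K (Suc i)) \<le> c"
proof -
  have Ksub: "subgroup (K i) G" "subgroup (K (Suc i)) G" "K (Suc i) \<subset> K i"
    using K i by (auto simp: strict_subgroup_chain_def)
  have "\<exists>j<n. K i \<subseteq> H j \<and> \<not> K i \<subseteq> H (Suc j)"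
  proof (rule ccontr)
    assume *: "\<not> (\<exists>j<n. K i \<subseteq> H j \<and> \<not> K i \<subseteq> H (Suc j))"
    have "j \<le> n \<Longrightarrow> K i \<subseteq> H j" for j
    proof (induction j)
      case 0
      then show ?case
        using H subgroup.subset[OF Ksub(1)] by (simp add: strict_subgroup_chain_def)
    qed (use * in auto)
    then have "K i \<subseteq> {\<one>}" using H by (auto simp: strict_subgroup_chain_def)
    then show False using Ksub(3) subgroup.one_closed[OF Ksub(2)] by blast
  qed
  then obtain j where j: "j < n" "K i \<subseteq> H j" "\<not> K i \<subseteq> H (Suc j)" by blast
  have "H (Suc j) \<in> K ` {..m}" using sub j(1) by auto
  then obtain l where l: "l \<le> m" "H (Suc j) = K l" by auto
  have "\<not> l \<le> i" using strict_chain_antimono[OF K, of l i] i l j(3) by auto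
  then have "H (Suc j) \<subseteq> K (Suc i)"
    using strict_chain_antimono[OF K, of "Suc i" l] l by simp
  moreover have "subgroup (H j) G" "subgroup (H (Suc j)) G"
    using H j(1) by (auto simp: strict_subgroup_chain_def)
  ultimately have "subgroup_index G (K i) (K (Suc i)) \<le> subgroup_index G (H j) (H (Suc j))"
    using subgroup_index_mono[OF fin] Ksub(1,2) j(2) by blast
  then show ?thesis using idx[OF j(1)] by simp
qed

lemma maximal_chain_exists:
  assumes fin: "finite (carrier G)" and path: "(carrier G, {\<one>}) \<in> (index_step G c)\<^sup>*"
  shows "\<exists>H n. maximal_subgroup_chain G H n \<and>
    (\<forall>i<n. subgroup_index G (H i) (H (Suc i)) \<le> c)"
proof -
  define P where "P n \<longleftrightarrow> (\<exists>H. strict_subgroup_chain G H n \<and>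
    (\<forall>i<n. subgroup_index G (H i) (H (Suc i)) \<le> c))" for n
  obtain n0 where "(carrier G, {\<one>}) \<in> index_step G c ^^ n0"
    using path rtrancl_imp_relpow by blast
  then obtain H0 where H0: "H0 0 = carrier G" "H0 n0 = {\<one>}"
    "\<And>i. i < n0 \<Longrightarrow> (H0 i, H0 (Suc i)) \<in> index_step G c"
    by (auto simp: relpow_fun_conv)
  have "subgroup (H0 i) G" if "i \<le> n0" for i
    using that H0(2) H0(3)[of i] triv_subgroup
    by (cases "i = n0") (auto simp: index_step_def)
  then have "P n0"
    unfolding P_def strict_subgroup_chain_def using H0
    by (intro exI[of _ H0]) (auto simp: index_step_def)
  moreover have "n \<le> card (carrier G)" if "P n" for n
    using that strict_chain_card[OF fin, of _ n n] unfolding P_def by fastforce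
  ultimately obtain n where n: "P n" and longest: "\<And>m. P m \<Longrightarrow> m \<le> n"
    by (metis GreatestI_nat Greatest_le_nat)
  then obtain H where H: "strict_subgroup_chain G H n"
    "\<And>i. i < n \<Longrightarrow> subgroup_index G (H i) (H (Suc i)) \<le> c"
    by (auto simp: P_def)
  have "maximal_subgroup_chain G H n"
    unfolding maximal_subgroup_chain_def
  proof (intro conjI notI)
    assume "\<exists>K m. strict_subgroup_chain G K m \<and> n < m \<and> H ` {..n} \<subseteq> K ` {..m}"
    then obtain K m where K: "strict_subgroup_chain G K m" "n < m" "H ` {..n} \<subseteq> K ` {..m}"
      by blast
    then have "P m" using chain_index_refine[OF fin H(1) K(1,3) H(2)] by (auto simp: P_def)
    then show False using longest K(2) by force
  qed (rule H(1))
  then show ?thesis using H(2) by blast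
qed

lemma composition_series_subgroup:
  assumes "composition_series G N n" "i \<le> n"
  shows "subgroup (N i) G"
  using assms(2)
proof (induction i)
  case 0
  then show ?case using assms(1) subgroup_self by (simp add: composition_series_def)
next
  case (Suc i)
  then have "subgroup (N (Suc i)) (G\<lparr>carrier := N i\<rparr>)"
    using assms(1) by (simp add: composition_series_def normal_imp_subgroup)
  then show ?case using Suc incl_subgroup by auto
qed

end

section \<open>The Galois width of a finite group\<close>

theorem theorem3:
  fixes G :: "('a, 'b) monoid_scheme" and N :: "nat \<Rightarrow> 'a set" and n :: nat
  assumes "group G" and "finite (carrier G)"
    and "composition_series G N n"
  shows "galois_width G =
    max_below n (\<lambda>i. min_faithful_degree (G\<lparr>carrier := N i\<rparr> Mod N (Suc i)))"
proof -
  interpret group G by fact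
  define S where "S i = G\<lparr>carrier := N i\<rparr> Mod N (Suc i)" for i
  define c where "c = max_below n (\<lambda>i. min_faithful_degree (S i))"
  have N: "subgroup (N i) G" if "i \<le> n" for i
    using composition_series_subgroup[OF assms(3) that] .
  have normal: "N (Suc i) \<lhd> G\<lparr>carrier := N i\<rparr>" and simple: "simple_group (S i)" if "i < n" for i
    using assms(3) that by (auto simp: composition_series_def S_def)
  have proj: "(\<lambda>a. N (Suc i) #>\<^bsub>G\<^esub> a) \<in> hom (G\<lparr>carrier := N i\<rparr>) (S i)" if "i < n" for i
    using normal.r_coset_hom_Mod[OF normal[OF that]] by (simp add: S_def)
  have onto: "(\<lambda>a. N (Suc i) #>\<^bsub>G\<^esub> a) ` N i = carrier (S i)" if "i < n" for i
    by (auto simp: S_def FactGroup_def RCOSETS_def)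
  have finS: "finite (carrier (S i))" if "i < n" for i
    using onto[OF that] N[of i] that assms(2) finite_subset[OF subgroup.subset]
    by (metis finite_imageI less_imp_le)
  have c_pos: "1 \<le> c"
  proof (cases "n = 0")
    case False
    then have "0 < min_faithful_degree (S 0)"
      using simple_group.min_faithful_degree_pos simple finS by blast
    also have "\<dots> \<le> c"
      unfolding c_def using False
      by (intro le_max_below[where f = "\<lambda>i. min_faithful_degree (S i)"]) simp
    finally show ?thesis by simp
  qed (simp add: c_def max_below_def)
  have step: "(N i, N (Suc i)) \<in> (index_step G c)\<^sup>*" if i: "i < n" for i
  proof -
    interpret Si: simple_group "S i" using simple[OF i] .
    let ?d = "min_faithful_degree (S i)"
    obtain \<phi> where \<phi>: "\<phi> \<in> hom (S i) (sym_group ?d)" "inj_on \<phi> (carrier (S i))"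
      using Si.min_faithful_degree_attained[OF finS[OF i]] by (auto simp: mon_def)
    have \<phi>_one: "\<phi> \<one>\<^bsub>S i\<^esub> = id"
      using hom_one[OF \<phi>(1) Si.is_group sym_group_is_group] by (simp add: sym_group_one)
    have one: "\<one>\<^bsub>S i\<^esub> = N (Suc i)" by (simp add: S_def)
    let ?\<psi> = "\<lambda>a. \<phi> (N (Suc i) #>\<^bsub>G\<^esub> a)"
    have hom: "?\<psi> \<in> hom (G\<lparr>carrier := N i\<rparr>) (sym_group ?d)"
      using Group.hom_compose[OF proj[OF i] \<phi>(1)] by (simp add: comp_def)
    have sub: "N (Suc i) \<subseteq> N i"
      using subgroup.subset[OF normal_imp_subgroup[OF normal[OF i]]] by simp
    have Ni: "subgroup (N i) G" "subgroup (N (Suc i)) G" using N i by auto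
    have "{a \<in> N i. ?\<psi> a = id} = N (Suc i)"
    proof (intro equalityI subsetI)
      fix a assume "a \<in> {a \<in> N i. ?\<psi> a = id}"
      then have a: "a \<in> N i" "?\<psi> a = id" by auto
      have "N (Suc i) #>\<^bsub>G\<^esub> a \<in> carrier (S i)" using onto[OF i] a(1) by blast
      then have "N (Suc i) #>\<^bsub>G\<^esub> a = N (Suc i)"
        using inj_onD[OF \<phi>(2), of "N (Suc i) #>\<^bsub>G\<^esub> a" "\<one>\<^bsub>S i\<^esub>"] a(2) \<phi>_one one
          group.is_monoid[OF Si.is_group, THEN monoid.one_closed] by simp
      then show "a \<in> N (Suc i)"
        using coset_join1[OF _ subgroup.mem_carrier[OF Ni(1) a(1)] Ni(2)] by simp
    next
      fix a assume a: "a \<in> N (Suc i)"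
      then have "N (Suc i) #>\<^bsub>G\<^esub> a = \<one>\<^bsub>S i\<^esub>"
        using coset_join2[OF subgroup.mem_carrier[OF Ni(2) a] Ni(2) a] one by simp
      then show "a \<in> {a \<in> N i. ?\<psi> a = id}" using a sub \<phi>_one by auto
    qed
    moreover have "?d \<le> c"
      unfolding c_def using i by (rule le_max_below[where f = "\<lambda>i. min_faithful_degree (S i)"])
    ultimately show ?thesis using stabilizer_chain[OF Ni(1) hom] by simp
  qed
  have "(N 0, N i) \<in> (index_step G c)\<^sup>*" if "i \<le> n" for i
    using that
  proof (induction i)
    case (Suc i)
    then show ?case using step[of i] by (meson Suc_le_lessD Suc_leD rtrancl_trans)
  qed simp
  then have "(carrier G, {\<one>\<^bsub>G\<^esub>}) \<in> (index_step G c)\<^sup>*"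
    using assms(3) by (metis composition_series_def order_refl)
  then obtain H m where H: "maximal_subgroup_chain G H m"
    "\<And>i. i < m \<Longrightarrow> subgroup_index G (H i) (H (Suc i)) \<le> c"
    using maximal_chain_exists[OF assms(2)] by blast
  have upper: "chain_cost G H m \<le> c"
    unfolding chain_cost_def using c_pos H(2) by (rule max_below_le)
  have lower: "c \<le> chain_cost G K k" if K: "strict_subgroup_chain G K k" for K k
    unfolding c_def
  proof (rule max_below_le)
    have "1 \<le> subgroup_index G (K 0) (K (Suc 0))" if "0 < k"
      using subgroup_index_pos[OF assms(2)] K
      by (metis less_eq_Suc_le One_nat_def le0 strict_subgroup_chain_def)
    also have "subgroup_index G (K 0) (K (Suc 0)) \<le> chain_cost G K k" if "0 < k"
      unfolding chain_cost_def using that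
      by (rule le_max_below[where f = "\<lambda>i. subgroup_index G (K i) (K (Suc i))"])
    finally show "1 \<le> chain_cost G K k"
      by (cases "k = 0") (auto simp: chain_cost_def max_below_def)
    show "min_faithful_degree (S i) \<le> chain_cost G K k" if "i < n" for i
      using min_faithful_degree_le_chain_cost[OF assms(2) K N simple proj onto] that by simp
  qed
  have "galois_width G = c"
    unfolding galois_width_def
  proof (rule Least_equality)
    have "c = chain_cost G H m"
      using upper lower H(1) by (auto simp: maximal_subgroup_chain_def intro: antisym)
    then show "\<exists>H n. maximal_subgroup_chain G H n \<and> c = chain_cost G H n" using H(1) by blast
  qed (use lower in \<open>auto simp: maximal_subgroup_chain_def\<close>)
  then show ?thesis by (simp add: c_def S_def)
qed

end
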